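(* ($q$-Bessel order case.) Let $0<|q|<1$ and let $a$ be a nonzero complex number. Then for $z\neq0$ for which the right-hand side is defined, $$\cfrac{1}{z-1+\cfrac{aq}{z-q+\cfrac{aq^2}{z-q^2+\cdots}}}=\frac{1}{z-1}\;\frac{{}_0\phi_1\left(\begin{matrix}-\\ q/z\end{matrix};\frac{aq^2}{z^2}\right)}{{}_0\phi_1\left(\begin{matrix}-\\ 1/z\end{matrix};\frac{aq}{z^2}\right)},$$ where the $n$-th partial numerator ($n\ge1$) is $aq^n$ and the partial denominators are $z-q^n$ ($n\ge0$).
   Context: Notation: $(c)_k=\prod_{j=0}^{k-1}(1-cq^j)$ and ${}_0\phi_1\left(\begin{matrix}-\\ c\end{matrix};w\right)=\sum_{k\ge0}\frac{q^{k(k-1)}}{(c)_k(q)_k}w^k$. "Defined" means that no lower parameter is of the form $q^{-k}$ ($k\ge0$) and the denominator does not vanish. *)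

theory Defs
  imports "HOL-Analysis.Analysis"
begin

definition qpochhammer :: "complex \<Rightarrow> complex \<Rightarrow> nat \<Rightarrow> complex" where
  "qpochhammer q c k = (\<Prod>j<k. 1 - c * q ^ j)"

text \<open>
  The series $_0\phi_1(-; c; w)$ in base $q$.  It is only meaningful if $c$ is not of the form
  $q^{-k}$; otherwise, almost all terms are \<open>0\<close> by the convention \<open>x / 0 = 0\<close>.
\<close>
definition phi01 :: "complex \<Rightarrow> complex \<Rightarrow> complex \<Rightarrow> complex" where
  "phi01 q c w =
     (\<Sum>k. q ^ (k * (k - 1)) / (qpochhammer q c k * qpochhammer q q k) * w ^ k)"

definition admissible_lower :: "complex \<Rightarrow> complex \<Rightarrow> bool" where
  "admissible_lower q c \<longleftrightarrow> (\<forall>k::nat. c \<noteq> 1 / q ^ k)"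

text \<open>
  Numerator $A_n$ and denominator $B_n$ of the $n$-th approximant of
  $b_0 + a_1/(b_1 + a_2/(b_2 + \cdots))$, by the usual three-term recurrences.
  The value \<open>a 0\<close> is never used.
\<close>
fun cf_num :: "(nat \<Rightarrow> complex) \<Rightarrow> (nat \<Rightarrow> complex) \<Rightarrow> nat \<Rightarrow> complex" where
  "cf_num a b 0 = b 0"
| "cf_num a b (Suc 0) = b 1 * b 0 + a 1"
| "cf_num a b (Suc (Suc n)) =
     b (Suc (Suc n)) * cf_num a b (Suc n) + a (Suc (Suc n)) * cf_num a b n"

fun cf_den :: "(nat \<Rightarrow> complex) \<Rightarrow> (nat \<Rightarrow> complex) \<Rightarrow> nat \<Rightarrow> complex" where
  "cf_den a b 0 = 1"
| "cf_den a b (Suc 0) = b 1"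
| "cf_den a b (Suc (Suc n)) =
     b (Suc (Suc n)) * cf_den a b (Suc n) + a (Suc (Suc n)) * cf_den a b n"

text \<open>
  Convergence to a finite value.  As usual, finitely many approximants may be infinite
  ($B_n = 0$); the first conjunct excludes that the convention \<open>x / 0 = 0\<close> plays any role
  in the limit.
\<close>
definition cf_converges_to ::
    "(nat \<Rightarrow> complex) \<Rightarrow> (nat \<Rightarrow> complex) \<Rightarrow> complex \<Rightarrow> bool" where
  "cf_converges_to a b L \<longleftrightarrow>
     (\<forall>\<^sub>F n in sequentially. cf_den a b n \<noteq> 0) \<and>
     (\<lambda>n. cf_num a b n / cf_den a b n) \<longlonglongrightarrow> L"

end

theory Submission
  imports Defs
begin

text \<open>
  Put \<open>f n = phi01 q (q^n/z) (a q^(n+1)/z^2)\<close>.  A contiguous relation reads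
  \<open>f n = f (n+1) + c n * f (n+2)\<close> with \<open>c n = a q^(n+1) / ((z - q^n) (z - q^(n+1)))\<close>, while the
  numerators and denominators of the approximants, divided by
  \<open>(z - 1) (z - q) \<cdots> (z - q^(n-1))\<close>, satisfy the adjoint recurrence
  \<open>y (n+2) = y (n+1) + c n * y n\<close>.  Hence \<open>y (n+1) * f (n+1) + c n * y n * f (n+2)\<close> is constant
  in \<open>n\<close>.  Since \<open>f n \<longlonglongrightarrow> 1\<close> and \<open>c n \<longlonglongrightarrow> 0\<close>, the sequence \<open>y\<close> converges to that constant,
  which is \<open>f 0\<close> for the denominators and \<open>f 1 / (z - 1)\<close> for the numerators.
\<close>

section \<open>Limits of solutions of linear recurrences\<close>

text \<open>Once \<open>norm (e n) < 1/2\<close>, the recurrence keeps \<open>y\<close> bounded.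
  Hence \<open>e n * y n\<close> tends to 0, and the limit of \<open>s\<close> passes to
  \<open>y (Suc n)\<close>.\<close>

lemma tendsto_affine_recurrence:
  fixes y s e :: "nat \<Rightarrow> 'a::real_normed_field"
  assumes rec: "\<forall>\<^sub>F n in sequentially. y (Suc n) = s n + e n * y n"
    and s: "s \<longlonglongrightarrow> l" and e: "e \<longlonglongrightarrow> 0"
  shows "y \<longlonglongrightarrow> l"
proof -
  have "Bseq s"
    using s by (intro convergent_imp_Bseq convergentI)
  then obtain C where C: "\<And>n. norm (s n) \<le> C"
    by (auto simp: Bseq_def)
  have "\<forall>\<^sub>F n in sequentially. norm (e n) < 1 / 2"
    using order_tendstoD(2)[OF tendsto_norm_zero[OF e], of "1/2"] by simp
  from eventually_conj[OF this rec] obtain N where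
    N: "\<And>n. n \<ge> N \<Longrightarrow> norm (e n) < 1 / 2 \<and> y (Suc n) = s n + e n * y n"
    by (auto simp: eventually_sequentially)
  \<comment> \<open>The first entry starts the induction; \<open>2 * C \<le> K\<close> gives
    \<open>C + K/2 \<le> K\<close> in its step.\<close>
  define K where "K = max (norm (y N)) (2 * C)"
  have "norm (y n) \<le> K" if "n \<ge> N" for n
    using that
  proof (induction n rule: dec_induct)
    case (step n)
    have "norm (y (Suc n)) \<le> norm (s n) + norm (e n) * norm (y n)"
      using N[of n] step.hyps by (metis norm_mult norm_triangle_ineq)
    also have "\<dots> \<le> C + 1 / 2 * K"
      using C[of n] N[of n] step by (intro add_mono mult_mono) auto
    also have "\<dots> \<le> K"
      by (auto simp: K_def)
    finally show ?case .
  qed (simp add: K_def)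
  then have "\<forall>\<^sub>F n in sequentially. norm (y n) \<le> K"
    by (auto simp: eventually_sequentially)
  then have "Bfun y sequentially"
    by (rule BfunI)
  then have "(\<lambda>n. e n * y n) \<longlonglongrightarrow> 0"
    using e unfolding tendsto_Zfun_iff diff_0_right
    by (intro bounded_bilinear.Zfun_prod_Bfun[OF bounded_bilinear_mult])
  from tendsto_add[OF s this] have "(\<lambda>n. s n + e n * y n) \<longlonglongrightarrow> l"
    by simp
  then have "(\<lambda>n. y (Suc n)) \<longlonglongrightarrow> l"
    by (rule Lim_transform_eventually) (use rec in \<open>auto elim: eventually_mono\<close>)
  then show ?thesis
    by (simp only: filterlim_sequentially_Suc)
qed

text \<open>Solving the invariant for \<open>y (n + 1)\<close> gives an affine recurrence whose
  coefficient \<open>- c n * f (n + 2) / f (n + 1)\<close> vanishes in the limit, so convergence of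
  \<open>y\<close> need not be known beforehand.\<close>

lemma tendsto_adjoint_recurrence:
  fixes f c y :: "nat \<Rightarrow> 'a::real_normed_field"
  assumes f_rec: "\<And>n. f n = f (n + 1) + c n * f (n + 2)"
    and y_rec: "\<And>n. y (n + 2) = y (n + 1) + c n * y n"
    and f: "f \<longlonglongrightarrow> 1" and c: "c \<longlonglongrightarrow> 0"
  shows "y \<longlonglongrightarrow> y 1 * f 1 + c 0 * y 0 * f 2"
proof -
  define L where "L = y 1 * f 1 + c 0 * y 0 * f 2"
  have inv: "y (n + 1) * f (n + 1) + c n * y n * f (n + 2) = L" for n
  proof (induction n)
    case (Suc n)
    have "y (n + 2) * f (n + 2) + c (n + 1) * y (n + 1) * f (n + 3)
        = (y (n + 1) + c n * y n) * f (n + 2) + y (n + 1) * (c (n + 1) * f (n + 3))"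
      by (simp only: y_rec ac_simps)
    also have "c (n + 1) * f (n + 3) = f (n + 1) - f (n + 2)"
      using f_rec[of "n + 1"] by (simp add: numeral_3_eq_3)
    finally show ?case
      using Suc.IH by (simp add: algebra_simps numeral_3_eq_3)
  qed (simp add: L_def numeral_2_eq_2)
  have f1: "(\<lambda>n. f (n + 1)) \<longlonglongrightarrow> 1" and f2: "(\<lambda>n. f (n + 2)) \<longlonglongrightarrow> 1"
    using f by (rule LIMSEQ_ignore_initial_segment)+
  have "y \<longlonglongrightarrow> L"
  proof (rule tendsto_affine_recurrence)
    \<comment> \<open>Some early values of \<open>f\<close> may vanish, so the division is valid
      only eventually.\<close>
    have "\<forall>\<^sub>F n in sequentially. f (n + 1) \<noteq> 0"
      using tendsto_imp_eventually_ne[OF f1] by simp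
    then show "\<forall>\<^sub>F n in sequentially.
        y (Suc n) = L / f (n + 1) + (- c n * f (n + 2) / f (n + 1)) * y n"
    proof eventually_elim
      case (elim n)
      then show ?case
        using inv[of n] by (simp add: field_simps)
    qed
    show "(\<lambda>n. L / f (n + 1)) \<longlonglongrightarrow> L"
      using tendsto_divide[OF tendsto_const f1, of L] by simp
    show "(\<lambda>n. - c n * f (n + 2) / f (n + 1)) \<longlonglongrightarrow> 0"
      using tendsto_divide[OF tendsto_mult[OF tendsto_minus[OF c] f2] f1] by simp
  qed
  then show ?thesis
    by (simp add: L_def)
qed

section \<open>Finite q-Pochhammer products and their bounds\<close>

lemma qpochhammer_0 [simp]: "qpochhammer q c 0 = 1"
  by (simp add: qpochhammer_def)

lemma qpochhammer_Suc: "qpochhammer q c (Suc k) = qpochhammer q c k * (1 - c * q ^ k)"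
  by (simp add: qpochhammer_def)

lemma qpochhammer_add:
  "qpochhammer q c (n + k) = qpochhammer q c n * qpochhammer q (c * q ^ n) k"
  by (induction k) (simp_all add: qpochhammer_Suc power_add mult.assoc)

lemma qpochhammer_Suc_left: "qpochhammer q c (Suc k) = (1 - c) * qpochhammer q (c * q) k"
  using qpochhammer_add[of q c 1 k] by (simp add: qpochhammer_def)

lemma qpochhammer_nonzero:
  assumes "\<And>j. c * q ^ j \<noteq> 1"
  shows "qpochhammer q c k \<noteq> 0"
  using assms by (auto simp: qpochhammer_def)

text \<open>The infinite product converges absolutely and no factor is 0, so its value is nonzero.
  The finite products and their inverses therefore both converge, hence are bounded.\<close>

lemma qpochhammer_bounded_away:
  assumes q: "norm q < 1" and c: "\<And>j. c * q ^ j \<noteq> 1"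
  obtains m M where "m > 0" "M > 0"
    "\<And>k. m \<le> norm (qpochhammer q c k)" "\<And>k. norm (qpochhammer q c k) \<le> M"
proof -
  have "summable (\<lambda>j. norm (- (c * q ^ j)))"
    using q by (auto simp: norm_mult norm_power intro!: summable_mult summable_geometric)
  then have "convergent_prod (\<lambda>j. 1 + - (c * q ^ j))"
    by (intro abs_convergent_prod_imp_convergent_prod)
       (simp add: abs_convergent_prod_conv_summable)
  then have cp: "convergent_prod (\<lambda>j. 1 - c * q ^ j)"
    by simp
  define P where "P = prodinf (\<lambda>j. 1 - c * q ^ j)"
  have "(\<lambda>n. \<Prod>j\<le>n. 1 - c * q ^ j) \<longlonglongrightarrow> P"
    unfolding P_def by (rule convergent_prod_LIMSEQ[OF cp])
  \<comment> \<open>The product over \<open>j \<le> n\<close> is the symbol at \<open>Suc n\<close>;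
    the index shift does not affect the limit.\<close>
  then have lim: "(\<lambda>n. qpochhammer q c n) \<longlonglongrightarrow> P"
    unfolding qpochhammer_def
    by (subst (asm) lessThan_Suc_atMost[symmetric]) (rule LIMSEQ_imp_Suc)
  have "P \<noteq> 0"
    unfolding P_def using c by (intro prodinf_nonzero[OF cp]) auto
  with lim have "(\<lambda>n. inverse (qpochhammer q c n)) \<longlonglongrightarrow> inverse P"
    by (rule tendsto_inverse)
  then have "Bseq (\<lambda>n. inverse (qpochhammer q c n))"
    by (meson convergentI convergent_imp_Bseq)
  then obtain K where K: "K > 0" "\<And>n. norm (inverse (qpochhammer q c n)) \<le> K"
    by (auto simp: Bseq_def)
  from lim have "Bseq (\<lambda>n. qpochhammer q c n)"
    by (meson convergentI convergent_imp_Bseq)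
  then obtain M where M: "M > 0" "\<And>n. norm (qpochhammer q c n) \<le> M"
    by (auto simp: Bseq_def)
  show thesis
  proof (rule that[of "1 / K" M])
    show "1 / K \<le> norm (qpochhammer q c k)" for k
      using K(1) K(2)[of k] qpochhammer_nonzero[OF c, of k]
      by (simp add: norm_inverse norm_divide divide_simps mult_ac split: if_splits)
  qed (use K M in auto)
qed

lemma mult_self_power_neq_1:
  fixes q :: complex
  assumes "norm q < 1"
  shows "q * q ^ j \<noteq> 1"
proof
  assume "q * q ^ j = 1"
  then have "norm q * norm q ^ j = 1"
    by (metis norm_mult norm_one norm_power)
  moreover have "norm q * norm q ^ j \<le> norm q"
    using assms by (simp add: mult_left_le power_le_one)
  ultimately show False
    using assms by simp
qed

section \<open>Convergence of the series and uniform majorants\<close>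

text \<open>Consecutive terms have ratio \<open>r ^ (2 * k) * x\<close>, which tends to 0. This
  series serves as the majorant for \<open>phi01\<close>.\<close>

lemma summable_theta:
  fixes r x :: real
  assumes "0 \<le> r" "r < 1" "0 \<le> x"
  shows "summable (\<lambda>k. r ^ (k * (k - 1)) * x ^ k)"
proof -
  have "(\<lambda>k. r ^ k * x) \<longlonglongrightarrow> 0"
    using assms by (auto intro!: tendsto_mult_left_zero LIMSEQ_power_zero)
  then have "\<forall>\<^sub>F k in sequentially. r ^ k * x < 1 / 2"
    by (rule order_tendstoD) simp
  then obtain N where N: "\<And>k. k \<ge> N \<Longrightarrow> r ^ k * x < 1 / 2"
    by (auto simp: eventually_sequentially)
  show ?thesis
  proof (rule summable_ratio_test[of "1/2" N])
    fix k assume "k \<ge> N"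
    have exponent: "Suc k * (Suc k - 1) = k * (k - 1) + k + k"
      by (cases k) (auto simp: algebra_simps)
    have "r ^ k * (r ^ k * x) \<le> 1 * (1 / 2)"
      using assms N[OF \<open>k \<ge> N\<close>] by (intro mult_mono power_le_one) auto
    then have "(r ^ (k * (k - 1)) * x ^ k) * (r ^ k * (r ^ k * x))
        \<le> (r ^ (k * (k - 1)) * x ^ k) * (1 / 2)"
      using assms by (intro mult_left_mono) auto
    then show "norm (r ^ (Suc k * (Suc k - 1)) * x ^ Suc k)
        \<le> 1 / 2 * norm (r ^ (k * (k - 1)) * x ^ k)"
      unfolding exponent using assms by (simp add: power_add abs_mult ac_simps)
  qed simp
qed

abbreviation phi01_term :: "complex \<Rightarrow> complex \<Rightarrow> complex \<Rightarrow> nat \<Rightarrow> complex" where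
  "phi01_term q c w k \<equiv> q ^ (k * (k - 1)) / (qpochhammer q c k * qpochhammer q q k) * w ^ k"

text \<open>Writing \<open>(c q^n)_k = (c)_(n+k) / (c)_n\<close> makes the bound uniform in \<open>n\<close>.\<close>

lemma phi01_term_bound:
  assumes q: "norm q < 1" and c: "\<And>j. c * q ^ j \<noteq> 1"
  obtains C where "C > 0"
    "\<And>n w k. norm (phi01_term q (c * q ^ n) w k) \<le> C * (norm q ^ (k * (k - 1)) * norm w ^ k)"
proof -
  obtain m M where m: "m > 0" "M > 0" "\<And>k. m \<le> norm (qpochhammer q c k)"
    "\<And>k. norm (qpochhammer q c k) \<le> M"
    using qpochhammer_bounded_away[OF q c] by metis
  obtain m' M' where m': "m' > 0" "M' > 0" "\<And>k. m' \<le> norm (qpochhammer q q k)"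
    "\<And>k. norm (qpochhammer q q k) \<le> M'"
    using qpochhammer_bounded_away[OF q mult_self_power_neq_1[OF q]] by metis
  have low: "m / M \<le> norm (qpochhammer q (c * q ^ n) k)" for n k
  proof -
    have "m \<le> norm (qpochhammer q c n) * norm (qpochhammer q (c * q ^ n) k)"
      using m(3)[of "n + k"] by (simp add: qpochhammer_add norm_mult)
    also have "\<dots> \<le> M * norm (qpochhammer q (c * q ^ n) k)"
      using m(4) by (intro mult_right_mono) auto
    finally show ?thesis
      using m(2) by (simp add: field_simps)
  qed
  have pos: "0 < m / M * m'"
    using m m' by simp
  have den: "m / M * m' \<le> norm (qpochhammer q (c * q ^ n) k) * norm (qpochhammer q q k)" for n k
    using low m m' by (intro mult_mono) auto
  show thesis
  proof (rule that[of "1 / (m / M * m')"])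
    show "1 / (m / M * m') > 0"
      using m m' by simp
    fix n w k
    have "norm (phi01_term q (c * q ^ n) w k)
        = 1 / (norm (qpochhammer q (c * q ^ n) k) * norm (qpochhammer q q k))
          * (norm q ^ (k * (k - 1)) * norm w ^ k)"
      by (simp add: norm_mult norm_divide norm_power)
    also have "\<dots> \<le> 1 / (m / M * m') * (norm q ^ (k * (k - 1)) * norm w ^ k)"
      using pos less_le_trans[OF pos den[of n k]]
      by (intro mult_right_mono divide_left_mono[OF den] mult_pos_pos[OF _ pos]) auto
    finally show "norm (phi01_term q (c * q ^ n) w k)
        \<le> 1 / (m / M * m') * (norm q ^ (k * (k - 1)) * norm w ^ k)" .
  qed
qed

lemma summable_phi01_term:
  assumes q: "norm q < 1" and c: "\<And>j. c * q ^ j \<noteq> 1"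
  shows "summable (phi01_term q c w)"
proof -
  obtain C where
    C: "\<And>n w k. norm (phi01_term q (c * q ^ n) w k) \<le> C * (norm q ^ (k * (k - 1)) * norm w ^ k)"
    using phi01_term_bound[OF q c] by metis
  show ?thesis
  proof (rule summable_comparison_test')
    show "summable (\<lambda>k. C * (norm q ^ (k * (k - 1)) * norm w ^ k))"
      using q by (intro summable_mult summable_theta) auto
    show "norm (phi01_term q c w k) \<le> C * (norm q ^ (k * (k - 1)) * norm w ^ k)" for k
      using C[where n = 0] by simp
  qed
qed

section \<open>Contiguous relation and limit under the shift\<close>

text \<open>The relation holds term by term: term \<open>k + 1\<close> of the difference of the
  first two series is the stated multiple of term \<open>k\<close> of the third. With
  \<open>Q = q ^ (k + 1)\<close>, the numerators combine to
  \<open>(1 - c * Q) - Q * (1 - c) = 1 - Q\<close>, which cancels the last factor of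
  \<open>qpochhammer q q (k + 1)\<close>.\<close>

lemma phi01_contiguous:
  assumes q: "norm q < 1" and c: "\<And>j. c * q ^ j \<noteq> 1"
  shows "phi01 q c w = phi01 q (c * q) (w * q)
           + w / ((1 - c) * (1 - c * q)) * phi01 q (c * q ^ 2) (w * q ^ 2)"
proof -
  have c1: "(c * q) * q ^ j \<noteq> 1" and c2: "(c * q ^ 2) * q ^ j \<noteq> 1" for j
    using c[of "j + 1"] c[of "j + 2"] by (simp_all add: power_add mult_ac power2_eq_square)
  have nz: "1 - c \<noteq> 0" "1 - c * q \<noteq> 0"
    using c[of 0] c[of 1] by auto
  let ?s = "\<lambda>k. phi01_term q c w k - phi01_term q (c * q) (w * q) k"
  have s_Suc: "?s (Suc k)
      = w / ((1 - c) * (1 - c * q)) * phi01_term q (c * q ^ 2) (w * q ^ 2) k" for k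
  proof -
    define P R Q T where "P = qpochhammer q (c * q ^ 2) k" and "R = qpochhammer q q k"
      and "Q = q ^ Suc k" and "T = qpochhammer q c (Suc k)"
    have nz': "P \<noteq> 0" "R \<noteq> 0" "1 - Q \<noteq> 0" "1 - c * Q \<noteq> 0"
      using qpochhammer_nonzero[OF c2] qpochhammer_nonzero[OF mult_self_power_neq_1[OF q]]
        mult_self_power_neq_1[OF q, of k] c[of "Suc k"]
      by (auto simp: P_def R_def Q_def)
    have R: "qpochhammer q q (Suc k) = R * (1 - Q)"
      by (simp add: R_def Q_def qpochhammer_Suc)
    have P: "qpochhammer q (c * q) (Suc k) = (1 - c * q) * P"
      by (simp add: P_def qpochhammer_Suc_left power2_eq_square mult_ac)
    \<comment> \<open>Both sides are \<open>qpochhammer q c (k + 2)\<close>, with the last factor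
      split off on the left and the first two on the right.\<close>
    have "T * (1 - c * Q) = (1 - c) * ((1 - c * q) * P)"
      unfolding T_def Q_def qpochhammer_Suc[symmetric] P[symmetric]
      by (rule qpochhammer_Suc_left)
    then have T: "T = (1 - c) * (1 - c * q) * P / (1 - c * Q)"
      using nz' by (simp add: field_simps)
    have ex: "q ^ (Suc k * (Suc k - 1)) = q ^ (k * (k - 1)) * (q ^ 2) ^ k"
    proof -
      have "Suc k * (Suc k - 1) = k * (k - 1) + 2 * k"
        by (cases k) (auto simp: algebra_simps)
      then show ?thesis
        by (simp only: power_add power_mult)
    qed
    \<comment> \<open>\<open>E / (P * R)\<close> is exactly term \<open>k\<close> of the third
      series.\<close>
    define E where "E = q ^ (k * (k - 1)) * (q ^ 2) ^ k * w ^ k"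
    have "?s (Suc k) = E * w / (T * (R * (1 - Q))) - E * w * Q / ((1 - c * q) * P * (R * (1 - Q)))"
      unfolding T_def[symmetric] R P ex E_def Q_def power_mult_distrib by (simp add: mult_ac)
    also have "\<dots> = E * w * ((1 - c * Q) - Q * (1 - c)) / ((1 - c) * (1 - c * q) * P * (R * (1 - Q)))"
      unfolding T using nz nz' by (simp add: divide_simps) (simp add: algebra_simps)
    also have "(1 - c * Q) - Q * (1 - c) = 1 - Q"
      by (simp add: algebra_simps)
    also have "E * w * (1 - Q) / ((1 - c) * (1 - c * q) * P * (R * (1 - Q)))
        = w / ((1 - c) * (1 - c * q)) * (E / (P * R))"
      using nz nz' by (simp add: divide_simps)
    finally show ?thesis
      by (simp add: E_def P_def R_def power_mult_distrib mult_ac)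
  qed
  have sm: "summable (phi01_term q c w)" "summable (phi01_term q (c * q) (w * q))"
    "summable (phi01_term q (c * q ^ 2) (w * q ^ 2))"
    using summable_phi01_term[OF q c] summable_phi01_term[OF q c1]
      summable_phi01_term[OF q c2] by blast+
  have "phi01 q c w - phi01 q (c * q) (w * q) = (\<Sum>k. ?s k)"
    unfolding phi01_def by (rule suminf_diff[OF sm(1,2)])
  \<comment> \<open>Both series start with the term 1, so \<open>?s 0 = 0\<close>.\<close>
  also have "\<dots> = (\<Sum>k. ?s (Suc k))"
    using suminf_split_head[OF summable_diff[OF sm(1,2)]] by simp
  also have "\<dots> = w / ((1 - c) * (1 - c * q)) * phi01 q (c * q ^ 2) (w * q ^ 2)"
    unfolding s_Suc phi01_def by (rule suminf_mult[OF sm(3)])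
  finally show ?thesis
    by (simp add: algebra_simps)
qed

text \<open>The term at \<open>k = 0\<close> is 1. Each later term carries
  \<open>(q ^ n) ^ k\<close> with \<open>k \<ge> 1\<close>, so by the bound uniform in
  \<open>n\<close> the rest is at most a constant times \<open>norm q ^ n\<close>.\<close>

lemma phi01_shift_tendsto_1:
  assumes q: "norm q < 1" and c: "\<And>j. c * q ^ j \<noteq> 1"
  shows "(\<lambda>n. phi01 q (c * q ^ n) (w * q ^ n)) \<longlonglongrightarrow> 1"
proof -
  obtain C where C: "C > 0"
    "\<And>n w k. norm (phi01_term q (c * q ^ n) w k) \<le> C * (norm q ^ (k * (k - 1)) * norm w ^ k)"
    using phi01_term_bound[OF q c] by metis
  define g where "g k = C * (norm q ^ (k * (k - 1)) * norm w ^ k)" for k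
  have g: "summable g"
    unfolding g_def using q by (intro summable_mult summable_theta) auto
  have bound: "norm (phi01 q (c * q ^ n) (w * q ^ n) - 1) \<le> (\<Sum>k. g (Suc k)) * norm q ^ n" for n
  proof -
    let ?t = "phi01_term q (c * q ^ n) (w * q ^ n)"
    have cn: "(c * q ^ n) * q ^ j \<noteq> 1" for j
      using c[of "n + j"] by (simp add: power_add mult_ac)
    have t: "norm (?t (Suc k)) \<le> g (Suc k) * norm q ^ n" for k
    proof -
      have "(norm q ^ n) ^ Suc k \<le> norm q ^ n"
        using q by (simp add: mult_left_le power_le_one)
      then have "g (Suc k) * (norm q ^ n) ^ Suc k \<le> g (Suc k) * norm q ^ n"
        using C(1) by (intro mult_left_mono) (auto simp: g_def)
      moreover have "norm (?t (Suc k)) \<le> g (Suc k) * (norm q ^ n) ^ Suc k"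
        using C(2)[where n = n and w = "w * q ^ n" and k = "Suc k"]
        unfolding g_def norm_mult norm_power power_mult_distrib by (simp only: mult_ac)
      ultimately show ?thesis
        by linarith
    qed
    have gs: "summable (\<lambda>k. g (Suc k))"
      using g by (simp add: summable_Suc_iff)
    have "phi01 q (c * q ^ n) (w * q ^ n) - 1 = (\<Sum>k. ?t (Suc k))"
      using suminf_split_head[OF summable_phi01_term[OF q cn, of "w * q ^ n"]]
      by (simp add: phi01_def)
    also have "norm \<dots> \<le> (\<Sum>k. g (Suc k) * norm q ^ n)"
      using t by (rule norm_suminf_le) (rule summable_mult2[OF gs])
    also have "\<dots> = (\<Sum>k. g (Suc k)) * norm q ^ n"
      by (rule suminf_mult2[OF gs, symmetric])
    finally show ?thesis .
  qed
  have "(\<lambda>n. (\<Sum>k. g (Suc k)) * norm q ^ n) \<longlonglongrightarrow> 0"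
    using q by (auto intro!: tendsto_mult_right_zero LIMSEQ_power_zero)
  then have "(\<lambda>n. phi01 q (c * q ^ n) (w * q ^ n) - 1) \<longlonglongrightarrow> 0"
    by (rule Lim_null_comparison[OF always_eventually, rotated]) (use bound in blast)
  then show ?thesis
    by (simp add: LIM_zero_iff)
qed

section \<open>Evaluation of the continued fraction\<close>

theorem mainTheorem17:
  fixes q a z :: complex
  assumes "0 < norm q" and "norm q < 1"
    and "a \<noteq> 0"
    and "z \<noteq> 0"
    and "admissible_lower q (q / z)"
    and "admissible_lower q (1 / z)"
    and "(z - 1) * phi01 q (1 / z) (a * q / z ^ 2) \<noteq> 0"
  shows "cf_converges_to
           (\<lambda>n. if n = 1 then 1 else a * q ^ (n - 1))
           (\<lambda>n. if n = 0 then 0 else z - q ^ (n - 1))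
           (1 / (z - 1) *
             (phi01 q (q / z) (a * q ^ 2 / z ^ 2) / phi01 q (1 / z) (a * q / z ^ 2)))"
proof -
  have q0: "q \<noteq> 0" and q: "norm q < 1"
    using assms(1,2) by auto
  have c: "1 / z * q ^ j \<noteq> 1" for j
    using assms(6) q0 \<open>z \<noteq> 0\<close> by (auto simp: admissible_lower_def field_simps)
  have z: "z - q ^ j \<noteq> 0" for j
    using c[of j] \<open>z \<noteq> 0\<close> by auto
  \<comment> \<open>The outermost \<open>1 / (z - 1 + ...)\<close> is encoded by
    \<open>?b 0 = 0\<close> and \<open>?a 1 = 1\<close>, so \<open>a * q ^ n\<close> and
    \<open>z - q ^ n\<close> sit at index \<open>n + 1\<close>.\<close>
  let ?a = "\<lambda>n. if n = 1 then 1 else a * q ^ (n - 1)"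
  let ?b = "\<lambda>n. if n = 0 then 0 else z - q ^ (n - 1)"
  define f where "f n = phi01 q (1 / z * q ^ n) (a * q / z ^ 2 * q ^ n)" for n
  \<comment> \<open>\<open>P n\<close> is the product of \<open>?b 1\<close> to \<open>?b n\<close>.
    Dividing by it normalizes the partial denominators to 1 and turns the partial numerators into
    \<open>e n = ?a (n + 2) / (?b (n + 1) * ?b (n + 2))\<close>.\<close>
  define e where "e n = a * q ^ (n + 1) / ((z - q ^ n) * (z - q ^ (n + 1)))" for n
  define P where "P n = (\<Prod>j<n. z - q ^ j)" for n
  have P: "P n \<noteq> 0" for n
    using z by (simp add: P_def)
  have f_rec: "f n = f (n + 1) + e n * f (n + 2)" for n
  proof -
    have "1 / z * q ^ n * q ^ j \<noteq> 1" for j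
      using c[of "n + j"] by (simp add: power_add)
    from phi01_contiguous[OF q this]
    have "f n = f (n + 1) + a * q / z ^ 2 * q ^ n
        / ((1 - 1 / z * q ^ n) * (1 - 1 / z * q ^ n * q)) * f (n + 2)"
      by (simp add: f_def power_add mult_ac power2_eq_square)
    also have "1 - 1 / z * q ^ n = (z - q ^ n) / z"
      using \<open>z \<noteq> 0\<close> by (simp add: field_simps)
    also have "1 - 1 / z * q ^ n * q = (z - q ^ (n + 1)) / z"
      using \<open>z \<noteq> 0\<close> by (simp add: field_simps)
    also have "a * q / z ^ 2 * q ^ n / ((z - q ^ n) / z * ((z - q ^ (n + 1)) / z)) = e n"
      using \<open>z \<noteq> 0\<close> z[of n] z[of "n + 1"] by (simp add: e_def field_simps power2_eq_square)
    finally show ?thesis .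
  qed
  have f_lim: "f \<longlonglongrightarrow> 1"
    unfolding f_def using phi01_shift_tendsto_1[OF q c] .
  have pow: "(\<lambda>n. q ^ n) \<longlonglongrightarrow> 0"
    using q by (rule LIMSEQ_power_zero)
  then have pow1: "(\<lambda>n. q ^ (n + 1)) \<longlonglongrightarrow> 0"
    by (rule LIMSEQ_ignore_initial_segment)
  have "e \<longlonglongrightarrow> a * 0 / ((z - 0) * (z - 0))"
    unfolding e_def using \<open>z \<noteq> 0\<close> by (intro tendsto_intros pow pow1) auto
  then have e_lim: "e \<longlonglongrightarrow> 0"
    by simp
  \<comment> \<open>Stated for arbitrary \<open>u\<close> to serve both \<open>cf_num\<close> and
    \<open>cf_den\<close>.\<close>
  have y_rec: "u (n + 2) / P (n + 2) = u (n + 1) / P (n + 1) + e n * (u n / P n)"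
    if "u (n + 2) = ?b (n + 2) * u (n + 1) + ?a (n + 2) * u n" for u n
  proof -
    have "P (n + 1) = P n * (z - q ^ n)" "P (n + 2) = P n * (z - q ^ n) * (z - q ^ (n + 1))"
      by (simp_all add: P_def)
    moreover have "?b (n + 2) = z - q ^ (n + 1)" "?a (n + 2) = a * q ^ (n + 1)"
      by simp_all
    ultimately show ?thesis
      unfolding that e_def using P[of n] z[of n] z[of "n + 1"]
      by (simp only: add_divide_distrib) (simp add: mult_ac)
  qed
  let ?A = "cf_num ?a ?b" and ?B = "cf_den ?a ?b"
  have "(\<lambda>n. ?A n / P n) \<longlonglongrightarrow> ?A 1 / P 1 * f 1 + e 0 * (?A 0 / P 0) * f 2"
    by (rule tendsto_adjoint_recurrence[OF f_rec y_rec f_lim e_lim]) simp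
  \<comment> \<open>Here \<open>?A 0 = 0\<close>, \<open>?A 1 = 1\<close> and
    \<open>P 1 = z - 1\<close>.\<close>
  also have "?A 1 / P 1 * f 1 + e 0 * (?A 0 / P 0) * f 2 = f 1 / (z - 1)"
    by (simp add: P_def)
  finally have A: "(\<lambda>n. ?A n / P n) \<longlonglongrightarrow> f 1 / (z - 1)" .
  have "(\<lambda>n. ?B n / P n) \<longlonglongrightarrow> ?B 1 / P 1 * f 1 + e 0 * (?B 0 / P 0) * f 2"
    by (rule tendsto_adjoint_recurrence[OF f_rec y_rec f_lim e_lim]) simp
  \<comment> \<open>Since \<open>?B 0 = P 0 = 1\<close> and \<open>?B 1 = P 1\<close>, the left side
    is \<open>f 1 + e 0 * f 2\<close>, the right side of \<open>f_rec\<close> at 0.\<close>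
  also have "?B 1 / P 1 * f 1 + e 0 * (?B 0 / P 0) * f 2 = f 0"
    using f_rec[of 0] z[of 0] by (simp add: P_def numeral_2_eq_2)
  finally have B: "(\<lambda>n. ?B n / P n) \<longlonglongrightarrow> f 0" .
  have f0: "f 0 \<noteq> 0"
    using assms(7) by (simp add: f_def)
  have "\<forall>\<^sub>F n in sequentially. ?B n / P n \<noteq> 0"
    using tendsto_imp_eventually_ne[OF B f0] .
  then have "\<forall>\<^sub>F n in sequentially. ?B n \<noteq> 0"
    by (rule eventually_mono) auto
  moreover have "(\<lambda>n. ?A n / ?B n) \<longlonglongrightarrow> f 1 / (z - 1) / f 0"
    using tendsto_divide[OF A B f0] P by simp
  moreover have "f 1 / (z - 1) / f 0 = 1 / (z - 1) *
      (phi01 q (q / z) (a * q ^ 2 / z ^ 2) / phi01 q (1 / z) (a * q / z ^ 2))"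
    by (simp add: f_def power2_eq_square mult_ac)
  ultimately show ?thesis
    unfolding cf_converges_to_def by simp
qed

end
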